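(* Let $\mathbb{F}$ be a field, let $V$ be an infinite-dimensional vector space over $\mathbb{F}$, and let $p_1,p_2,p_3\in\mathbb{F}[t]$ be split polynomials of degree $2$. Let $u$ be an endomorphism of $V$ with a dominant eigenvalue $\lambda$ such that $u-\lambda\,\mathrm{id}_V$ has infinite rank. Assume that $\lambda$ is a $(p_1,p_2,p_3)$-sum or $2\lambda=\operatorname{tr}p_1+\operatorname{tr}p_2+\operatorname{tr}p_3$. Then $u$ is a $(p_1,p_2,p_3)$-sum.
   Context: A scalar $\lambda$ is a dominant eigenvalue of $u\in\mathrm{End}(V)$ if $\operatorname{rk}(u-\lambda\,\mathrm{id}_V)<\dim V$. An endomorphism $u$ is a $(p_1,p_2,p_3)$-sum if $u=u_1+u_2+u_3$ for some endomorphisms $u_k$ of $V$ with $p_k(u_k)=0$ for all $k$. A scalar $\lambda$ is a $(p_1,p_2,p_3)$-sum if $\lambda=x_1+x_2+x_3$ for some $x_k\in\mathbb{F}$ with $p_k(x_k)=0$ for all $k$. The trace of a monic polynomial of degree $n>0$ is the opposite of its coefficient on $t^{n-1}$; the trace $\operatorname{tr}p$ of a nonconstant polynomial $p$ with leading coefficient $\alpha$ is the trace of $\alpha^{-1}p$. *)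

theory Defs
  imports Main "HOL-Computational_Algebra.Polynomial"
begin

text \<open>Vector spaces over a field 'a are given as a type 'v with a scalar
multiplication scale satisfying the locale vector_space scale.\<close>

definition is_basis_of :: "('a::field \<Rightarrow> 'v::ab_group_add \<Rightarrow> 'v) \<Rightarrow> 'v set \<Rightarrow> 'v set \<Rightarrow> bool" where
  "is_basis_of scale B W \<longleftrightarrow> B \<subseteq> W \<and> \<not> module.dependent scale B \<and> module.span scale B = W"

definition rank_less_dim :: "('a::field \<Rightarrow> 'v::ab_group_add \<Rightarrow> 'v) \<Rightarrow> ('v \<Rightarrow> 'v) \<Rightarrow> bool" where
  "rank_less_dim scale f \<longleftrightarrow>
     (\<exists>B C. is_basis_of scale B (range f) \<and> is_basis_of scale C UNIV \<and>
            (card_of B, card_of C) \<in> ordLess)"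

definition infinite_rank :: "('a::field \<Rightarrow> 'v::ab_group_add \<Rightarrow> 'v) \<Rightarrow> ('v \<Rightarrow> 'v) \<Rightarrow> bool" where
  "infinite_rank scale f \<longleftrightarrow> \<not> (\<exists>S. finite S \<and> module.span scale S = range f)"

definition infinite_dimensional :: "('a::field \<Rightarrow> 'v::ab_group_add \<Rightarrow> 'v) \<Rightarrow> bool" where
  "infinite_dimensional scale \<longleftrightarrow> \<not> (\<exists>S. finite S \<and> module.span scale S = UNIV)"

definition dominant_eigenvalue :: "('a::field \<Rightarrow> 'v::ab_group_add \<Rightarrow> 'v) \<Rightarrow> ('v \<Rightarrow> 'v) \<Rightarrow> 'a \<Rightarrow> bool" where
  "dominant_eigenvalue scale u l \<longleftrightarrow> rank_less_dim scale (\<lambda>v. u v - scale l v)"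

definition poly_endo :: "('a::field \<Rightarrow> 'v::ab_group_add \<Rightarrow> 'v) \<Rightarrow> 'a poly \<Rightarrow> ('v \<Rightarrow> 'v) \<Rightarrow> 'v \<Rightarrow> 'v" where
  "poly_endo scale p f = (\<lambda>v. \<Sum>i\<le>degree p. scale (coeff p i) ((f ^^ i) v))"

definition is_sum3_endo :: "('a::field \<Rightarrow> 'v::ab_group_add \<Rightarrow> 'v) \<Rightarrow> 'a poly \<Rightarrow> 'a poly \<Rightarrow> 'a poly \<Rightarrow> ('v \<Rightarrow> 'v) \<Rightarrow> bool" where
  "is_sum3_endo scale p1 p2 p3 u \<longleftrightarrow>
     (\<exists>u1 u2 u3. Vector_Spaces.linear scale scale u1 \<and> Vector_Spaces.linear scale scale u2 \<and> Vector_Spaces.linear scale scale u3 \<and>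
        poly_endo scale p1 u1 = (\<lambda>_. 0) \<and> poly_endo scale p2 u2 = (\<lambda>_. 0) \<and>
        poly_endo scale p3 u3 = (\<lambda>_. 0) \<and> u = (\<lambda>v. u1 v + u2 v + u3 v))"

definition is_sum3_scalar :: "'a::field poly \<Rightarrow> 'a poly \<Rightarrow> 'a poly \<Rightarrow> 'a \<Rightarrow> bool" where
  "is_sum3_scalar p1 p2 p3 l \<longleftrightarrow>
     (\<exists>x1 x2 x3. poly p1 x1 = 0 \<and> poly p2 x2 = 0 \<and> poly p3 x3 = 0 \<and> l = x1 + x2 + x3)"

definition poly_trace :: "'a::field poly \<Rightarrow> 'a" where
  "poly_trace p = - coeff p (degree p - 1) / lead_coeff p"

definition split_deg2 :: "'a::field poly \<Rightarrow> bool" where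
  "split_deg2 p \<longleftrightarrow> degree p = 2 \<and>
     (\<exists>a b. p = smult (lead_coeff p) ([:-a, 1:] * [:-b, 1:]))"

end

theory Submission
  imports Defs
begin

text \<open>A 2-by-2 matrix of operators whose formal trace (sum of the diagonal operators) is the scalar
  \<open>tr p1 + tr p2 + tr p3\<close> is a sum of the required form. Put \<open>g = u - l\<close>. Since \<open>rk g < dim V\<close>, there
  is a splitting \<open>V = W \<oplus> K \<oplus> L\<close> with \<open>K \<simeq> W\<close> of dimension \<open>rk g\<close>, with \<open>g = 0\<close> on \<open>K \<oplus> L\<close>, and
  with \<open>g = \<beta> + S\<close> on \<open>W\<close>, where \<open>\<beta>\<close> maps into \<open>W\<close> and \<open>S\<close> into \<open>K\<close> is a right shift of infinite
  multiplicity. Every operator of \<open>W\<close> is a commutator of \<open>S\<close>, so the complement of \<open>W\<close> in \<open>W \<oplus> K\<close>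
  can be moved until the trace condition holds there. On \<open>L\<close> the operator is the scalar \<open>l\<close>, which is
  either a sum of three roots or, doubled on pairs of basis vectors, satisfies the trace condition.\<close>

unbundle cardinal_syntax

section \<open>Cardinal arithmetic and roots of quadratic polynomials\<close>

lemma card_of_Un_ordLeq_infinite:
  assumes "infinite C" "|A| \<le>o |C|" "|B| \<le>o |C|"
  shows "|A \<union> B| \<le>o |C|"
  using card_of_Un_ordLeq_infinite_Field[OF _ assms(2,3) card_of_Card_order] assms(1)
  by (simp add: Field_card_of)

text \<open>An infinite set has the size of its double. This later groups the basis vectors of
  \<open>L\<close> into pairs.\<close>

lemma infinite_split_halves:
  assumes "infinite X"
  obtains f1 f2 where "inj_on f1 X" "inj_on f2 X" "f1 ` X \<inter> f2 ` X = {}" "f1 ` X \<union> f2 ` X = X"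
proof -
  have "|X <+> X| =o |X|"
    using card_of_Plus_infinite1[OF assms ordLeq_reflexive[OF card_of_Well_order]] .
  then obtain f where "bij_betw f (X <+> X) X"
    unfolding card_of_ordIso[symmetric] by blast
  then have f: "inj_on f (X <+> X)" "f ` (X <+> X) = X" by (simp_all add: bij_betw_def)
  show thesis
  proof (rule that[of "f \<circ> Inl" "f \<circ> Inr"])
    show "inj_on (f \<circ> Inl) X" "inj_on (f \<circ> Inr) X" "(f \<circ> Inl) ` X \<inter> (f \<circ> Inr) ` X = {}"
      using inj_onD[OF f(1)] by (fastforce simp: inj_on_def)+
    show "(f \<circ> Inl) ` X \<union> (f \<circ> Inr) ` X = X"
      using f(2) by (simp add: Plus_def image_Un image_comp)
  qed
qed

text \<open>Vieta's formulas with roots counted with multiplicity, so \<open>a = b\<close> is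
  allowed; the leading coefficient \<open>c\<close> cancels from the trace.\<close>

lemma split_deg2_roots:
  fixes p :: "'a::field poly"
  assumes "split_deg2 p"
  obtains a b c where "degree p = 2" "coeff p 0 = c * (a * b)" "coeff p (Suc 0) = - (c * (a + b))"
    "coeff p 2 = c" "poly_trace p = a + b" "\<And>x. poly p x = 0 \<Longrightarrow> x = a \<or> x = b"
proof -
  define c where "c = lead_coeff p"
  obtain a b where p: "degree p = 2" "p = smult c ([:-a, 1:] * [:-b, 1:])"
    using assms unfolding split_deg2_def c_def by blast
  have c: "c \<noteq> 0" unfolding c_def using p(1) by (metis degree_0 leading_coeff_0_iff zero_neq_numeral)
  have coeffs: "coeff p 0 = c * (a * b)" "coeff p (Suc 0) = - (c * (a + b))" "coeff p 2 = c"
    by (subst p(2); simp add: numeral_2_eq_2 algebra_simps)+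
  show thesis
  proof (rule that[OF p(1) coeffs])
    show "poly_trace p = a + b" using c by (simp add: poly_trace_def p(1) coeffs)
    show "x = a \<or> x = b" if "poly p x = 0" for x
    proof -
      have "poly p x = c * ((x - a) * (x - b))"
        by (subst p(2)) (simp add: algebra_simps)
      with that c show ?thesis by simp
    qed
  qed
qed

section \<open>Linear maps and their values on a basis\<close>

locale endo_space = vector_space scale
  for scale :: "'a::field \<Rightarrow> 'b::ab_group_add \<Rightarrow> 'b" (infixr \<open>*s\<close> 75)
begin

abbreviation lin :: "('b \<Rightarrow> 'b) \<Rightarrow> bool" where
  "lin f \<equiv> Vector_Spaces.linear scale scale f"

lemma linI:
  assumes "\<And>x y. f (x + y) = f x + f y" and "\<And>c x. f (c *s x) = c *s f x"
  shows "lin f"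
  using assms vector_space_axioms unfolding Vector_Spaces.linear_iff by blast

lemma lin_simps:
  assumes "lin f"
  shows "f (x + y) = f x + f y" and "f (c *s x) = c *s f x"
    and "f (x - y) = f x - f y" and "f (- x) = - f x" and "f 0 = 0"
proof -
  interpret f: Vector_Spaces.linear scale scale f by (fact assms)
  show "f (x + y) = f x + f y" "f (c *s x) = c *s f x"
    "f (x - y) = f x - f y" "f (- x) = - f x" "f 0 = 0"
    by (simp_all add: f.add f.scale f.diff f.neg)
qed

lemma lin_eq_on_span:
  assumes "lin f" "lin g" "x \<in> span B" "\<And>b. b \<in> B \<Longrightarrow> f b = g b"
  shows "f x = g x"
proof -
  interpret vector_space_pair scale scale by unfold_locales
  show ?thesis using linear_eq_on[OF assms] .
qed

lemma lin_span_mem: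
  assumes "lin f" "x \<in> span B" "\<And>b. b \<in> B \<Longrightarrow> f b \<in> span C"
  shows "f x \<in> span C"
  using assms(2)
proof (induction rule: span_induct)
  case base show ?case by (auto simp: subspace_def lin_simps[OF assms(1)] span_zero span_add span_scale)
next
  case (step x) then show ?case by (rule assms(3))
qed

lemma lin_extend:
  assumes "independent B"
  obtains f where "lin f" "\<And>b. b \<in> B \<Longrightarrow> f b = h b"
proof -
  interpret vector_space_pair scale scale by unfold_locales
  show thesis using linear_independent_extend[OF assms, of h] that by blast
qed

section \<open>Sums of three quadratic operators on the range of a projection\<close>

text \<open>For a projection \<open>Q\<close>, such an \<open>f\<close> is an operator of the range
  of \<open>Q\<close> annihilated by (t - a)(t - b), extended by zero to the kernel of
  \<open>Q\<close>.\<close>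

definition quadratic_on :: "'a \<Rightarrow> 'a \<Rightarrow> ('b \<Rightarrow> 'b) \<Rightarrow> ('b \<Rightarrow> 'b) \<Rightarrow> bool" where
  "quadratic_on a b Q f \<longleftrightarrow> lin f \<and>
     (\<forall>v. Q (f v) = f v \<and> f (Q v) = f v \<and> f (f v) = (a + b) *s f v - (a * b) *s Q v)"

text \<open>The polynomials enter only through their roots. For linear \<open>Q\<close> the equation
  also forces \<open>u\<close> to map the range of \<open>Q\<close> into itself.\<close>

definition sum3_on ::
  "'a \<Rightarrow> 'a \<Rightarrow> 'a \<Rightarrow> 'a \<Rightarrow> 'a \<Rightarrow> 'a \<Rightarrow> ('b \<Rightarrow> 'b) \<Rightarrow> ('b \<Rightarrow> 'b) \<Rightarrow> bool" where
  "sum3_on a1 b1 a2 b2 a3 b3 Q u \<longleftrightarrow>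
     (\<exists>u1 u2 u3. quadratic_on a1 b1 Q u1 \<and> quadratic_on a2 b2 Q u2 \<and> quadratic_on a3 b3 Q u3 \<and>
        (\<forall>v. u1 v + u2 v + u3 v = u (Q v)))"

text \<open>Since \<open>f\<close> factors through \<open>Q\<close> and \<open>Q'\<close> fixes the
  values of \<open>g\<close>, the cross terms \<open>f (g v)\<close> and \<open>g (f v)\<close>
  vanish.\<close>

lemma quadratic_on_add:
  assumes f: "quadratic_on a b Q f" and g: "quadratic_on a b Q' g"
    and "\<And>v. Q (Q' v) = 0" "\<And>v. Q' (Q v) = 0" "\<And>v. Q v + Q' v = v"
  shows "quadratic_on a b (\<lambda>v. v) (\<lambda>v. f v + g v)"
proof -
  have lf: "lin f" and lg: "lin g" using f g by (auto simp: quadratic_on_def)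
  have "f (g v) = 0" for v
    using f g assms(3) lin_simps(5)[OF lf] unfolding quadratic_on_def by metis
  moreover have "g (f v) = 0" for v
    using f g assms(4) lin_simps(5)[OF lg] unfolding quadratic_on_def by metis
  moreover have "(a * b) *s Q v + (a * b) *s Q' v = (a * b) *s v" for v
    by (metis assms(5) scale_right_distrib)
  moreover have "lin (\<lambda>v. f v + g v)"
    by (rule linI) (simp_all add: lin_simps[OF lf] lin_simps[OF lg] algebra_simps)
  moreover have "f (f v) + g (g v) = (a + b) *s (f v + g v) - ((a * b) *s Q v + (a * b) *s Q' v)" for v
    using f g by (simp add: quadratic_on_def algebra_simps)
  ultimately show ?thesis
    by (simp add: quadratic_on_def lin_simps[OF lf] lin_simps[OF lg])
qed

lemma sum3_on_add:
  assumes "sum3_on a1 b1 a2 b2 a3 b3 Q u" "sum3_on a1 b1 a2 b2 a3 b3 Q' u" "lin u"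
    and Q: "\<And>v. Q (Q' v) = 0" "\<And>v. Q' (Q v) = 0" "\<And>v. Q v + Q' v = v"
  shows "sum3_on a1 b1 a2 b2 a3 b3 (\<lambda>v. v) u"
proof -
  obtain f1 f2 f3 where f: "quadratic_on a1 b1 Q f1" "quadratic_on a2 b2 Q f2" "quadratic_on a3 b3 Q f3"
    "\<And>v. f1 v + f2 v + f3 v = u (Q v)" using assms(1) unfolding sum3_on_def by blast
  obtain g1 g2 g3 where g: "quadratic_on a1 b1 Q' g1" "quadratic_on a2 b2 Q' g2" "quadratic_on a3 b3 Q' g3"
    "\<And>v. g1 v + g2 v + g3 v = u (Q' v)" using assms(2) unfolding sum3_on_def by blast
  have "(f1 v + g1 v) + (f2 v + g2 v) + (f3 v + g3 v) = u v" for v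
  proof -
    have "(f1 v + g1 v) + (f2 v + g2 v) + (f3 v + g3 v) = u (Q v) + u (Q' v)"
      unfolding f(4)[symmetric] g(4)[symmetric] by (simp add: algebra_simps)
    also have "\<dots> = u v" by (metis Q(3) lin_simps(1)[OF assms(3)])
    finally show ?thesis .
  qed
  then show ?thesis unfolding sum3_on_def
    using quadratic_on_add[OF f(1) g(1) Q] quadratic_on_add[OF f(2) g(2) Q]
      quadratic_on_add[OF f(3) g(3) Q] by blast
qed

text \<open>Each summand can be a root times \<open>Q\<close>, because a root satisfies the
  quadratic relation itself.\<close>

lemma sum3_on_scalar:
  assumes Q: "lin Q" "\<And>v. Q (Q v) = Q v" and u: "\<And>v. u (Q v) = (x1 + x2 + x3) *s Q v"
    and "x1 = a1 \<or> x1 = b1" "x2 = a2 \<or> x2 = b2" "x3 = a3 \<or> x3 = b3"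
  shows "sum3_on a1 b1 a2 b2 a3 b3 Q u"
proof -
  have *: "quadratic_on a b Q (\<lambda>v. x *s Q v)" if "x = a \<or> x = b" for x a b
  proof -
    have "x * x = (a + b) * x - a * b" using that by (auto simp: algebra_simps)
    then have "x *s x *s Q v = (a + b) *s x *s Q v - (a * b) *s Q v" for v
      by (simp add: scale_left_diff_distrib)
    moreover have "lin (\<lambda>v. x *s Q v)"
      by (rule linI) (simp_all add: lin_simps[OF Q(1)] scale_right_distrib mult.commute)
    ultimately show ?thesis
      by (simp add: quadratic_on_def lin_simps[OF Q(1)] Q(2))
  qed
  have "x1 *s Q v + x2 *s Q v + x3 *s Q v = u (Q v)" for v
    by (simp add: u scale_left_distrib)
  then show ?thesis unfolding sum3_on_def
    using *[OF assms(4)] *[OF assms(5)] *[OF assms(6)] by blast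
qed

text \<open>Here \<open>p, q, e, e'\<close> identify the range of \<open>Q\<close> with \<open>W \<oplus> W\<close>. The third summand is
  \<open>[[A, - p3 A], [1, a3 + b3 - A]]\<close>, with \<open>A\<close> chosen so that the difference has diagonal
  \<open>a1 + a2, b1 + b2\<close>; such an operator is the sum of a lower and of an upper triangular one.\<close>

lemma sum3_on_trace:
  fixes p q e e' u :: "'b \<Rightarrow> 'b"
  assumes lin: "lin p" "lin q" "lin e" "lin e'" "lin u"
    and W: "subspace W" "\<And>v. p v \<in> W" "\<And>v. q v \<in> W"
    and pe: "\<And>z. z \<in> W \<Longrightarrow> p (e z) = z" "\<And>z. z \<in> W \<Longrightarrow> q (e z) = 0"
      "\<And>z. z \<in> W \<Longrightarrow> p (e' z) = 0" "\<And>z. z \<in> W \<Longrightarrow> q (e' z) = z"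
    and Q: "\<And>v. Q v = e (p v) + e' (q v)"
    and stable: "\<And>z. z \<in> W \<Longrightarrow> Q (u (e z)) = u (e z)" "\<And>z. z \<in> W \<Longrightarrow> Q (u (e' z)) = u (e' z)"
    and trace: "\<And>z. z \<in> W \<Longrightarrow> p (u (e z)) + q (u (e' z)) = (a1 + b1 + a2 + b2 + a3 + b3) *s z"
  shows "sum3_on a1 b1 a2 b2 a3 b3 Q u"
proof -
  define mat where "mat M11 M12 M21 M22 v =
      e (M11 (p v) + M12 (q v)) + e' (M21 (p v) + M22 (q v))"
    for M11 M12 M21 M22 :: "'b \<Rightarrow> 'b" and v
  note ls = lin_simps[OF lin(1)] lin_simps[OF lin(2)] lin_simps[OF lin(3)] lin_simps[OF lin(4)]
    lin_simps[OF lin(5)]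
  note Wc = subspace_add[OF W(1)] subspace_diff[OF W(1)] subspace_scale[OF W(1)] subspace_0[OF W(1)] W(2,3)
  \<comment> \<open>The four identities \<open>sq\<close> are the entries of M^2 = (a + b) M - a b,
    demanded only on \<open>W\<close>.\<close>
  have mat: "quadratic_on a b Q (mat M11 M12 M21 M22)"
    if l: "lin M11" "lin M12" "lin M21" "lin M22"
      and m: "\<And>z. z \<in> W \<Longrightarrow> M11 z \<in> W" "\<And>z. z \<in> W \<Longrightarrow> M12 z \<in> W"
        "\<And>z. z \<in> W \<Longrightarrow> M21 z \<in> W" "\<And>z. z \<in> W \<Longrightarrow> M22 z \<in> W"
      and sq: "\<And>z. z \<in> W \<Longrightarrow> M11 (M11 z) + M12 (M21 z) = (a + b) *s M11 z - (a * b) *s z"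
        "\<And>z. z \<in> W \<Longrightarrow> M11 (M12 z) + M12 (M22 z) = (a + b) *s M12 z"
        "\<And>z. z \<in> W \<Longrightarrow> M21 (M11 z) + M22 (M21 z) = (a + b) *s M21 z"
        "\<And>z. z \<in> W \<Longrightarrow> M21 (M12 z) + M22 (M22 z) = (a + b) *s M22 z - (a * b) *s z"
    for a b M11 M12 M21 M22
  proof -
    note ml = lin_simps[OF l(1)] lin_simps[OF l(2)] lin_simps[OF l(3)] lin_simps[OF l(4)]
    have pm: "p (mat M11 M12 M21 M22 v) = M11 (p v) + M12 (q v)"
      and qm: "q (mat M11 M12 M21 M22 v) = M21 (p v) + M22 (q v)" for v
      by (simp_all add: mat_def ls pe Wc m)
    have pq: "p (Q v) = p v" "q (Q v) = q v" for v by (simp_all add: Q ls pe Wc)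
    have "mat M11 M12 M21 M22 (mat M11 M12 M21 M22 v) =
        (a + b) *s mat M11 M12 M21 M22 v - (a * b) *s Q v" for v
    proof -
      have "mat M11 M12 M21 M22 (mat M11 M12 M21 M22 v)
         = e ((M11 (M11 (p v)) + M12 (M21 (p v))) + (M11 (M12 (q v)) + M12 (M22 (q v))))
         + e' ((M21 (M11 (p v)) + M22 (M21 (p v))) + (M21 (M12 (q v)) + M22 (M22 (q v))))"
        unfolding mat_def[of _ _ _ _ "mat M11 M12 M21 M22 v"] pm qm by (simp add: ml algebra_simps)
      also have "\<dots> = e (((a + b) *s M11 (p v) - (a * b) *s p v) + (a + b) *s M12 (q v))
         + e' ((a + b) *s M21 (p v) + ((a + b) *s M22 (q v) - (a * b) *s q v))"
        by (simp only: sq Wc)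
      also have "\<dots> = (a + b) *s mat M11 M12 M21 M22 v - (a * b) *s Q v"
        by (simp add: mat_def Q ls algebra_simps)
      finally show ?thesis .
    qed
    moreover have "lin (mat M11 M12 M21 M22)"
      by (rule linI) (simp_all add: mat_def ls ml algebra_simps)
    moreover have "Q (mat M11 M12 M21 M22 v) = mat M11 M12 M21 M22 v" for v
      unfolding Q pm qm by (simp add: mat_def)
    moreover have "mat M11 M12 M21 M22 (Q v) = mat M11 M12 M21 M22 v" for v
      by (simp add: mat_def pq)
    ultimately show ?thesis by (auto simp: quadratic_on_def)
  qed
  define A where "A z = p (u (e z)) - (a1 + a2) *s z" for z
  define X where "X z = p (u (e' z))" for z
  define Y where "Y z = q (u (e z))" for z
  define R where "R z = A (A z) - (a3 + b3) *s A z + (a3 * b3) *s z" for z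
  have lA: "lin A" and lX: "lin X" and lY: "lin Y"
    by (rule linI; simp add: A_def X_def Y_def ls algebra_simps)+
  note la = lin_simps[OF lA] lin_simps[OF lX] lin_simps[OF lY]
  have lR: "lin R" by (rule linI) (simp_all add: R_def la algebra_simps)
  have AW: "A z \<in> W" if "z \<in> W" for z using that by (simp add: A_def Wc)
  have XW: "X z \<in> W" and YW: "Y z \<in> W" for z by (simp_all add: X_def Y_def Wc)
  have RW: "R z \<in> W" if "z \<in> W" for z using that by (simp add: R_def AW Wc)
  \<comment> \<open>Triangular matrices with scalar diagonal satisfy their quadratic whatever the
    corner is. The corners \<open>X z + R z\<close> and \<open>Y z - z\<close> absorb the entries
    \<open>- R z\<close> and \<open>z\<close> of \<open>?u3\<close>, leaving \<open>X\<close> and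
    \<open>Y\<close>.\<close>
  let ?u1 = "mat (\<lambda>z. a1 *s z) (\<lambda>z. X z + R z) (\<lambda>z. 0) (\<lambda>z. b1 *s z)"
  let ?u2 = "mat (\<lambda>z. a2 *s z) (\<lambda>z. 0) (\<lambda>z. Y z - z) (\<lambda>z. b2 *s z)"
  \<comment> \<open>As \<open>R\<close> is (t - a3)(t - b3) evaluated at \<open>A\<close>, this
    matrix of commuting blocks has formal trace \<open>a3 + b3\<close> and formal determinant
    \<open>a3 * b3\<close>; Cayley-Hamilton gives its quadratic relation.\<close>
  let ?u3 = "mat A (\<lambda>z. - R z) (\<lambda>z. z) (\<lambda>z. (a3 + b3) *s z - A z)"
  have lins: "lin (\<lambda>z. c *s z)" "lin (\<lambda>z. X z + R z)" "lin (\<lambda>z. 0)" "lin (\<lambda>z. Y z - z)"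
    "lin (\<lambda>z. - R z)" "lin (\<lambda>z. z)" "lin (\<lambda>z. c *s z - A z)" for c
    by (rule linI; simp add: la lin_simps[OF lR] algebra_simps)+
  have AR: "A (R z) = R (A z)" for z by (simp add: R_def la)
  have "quadratic_on a1 b1 Q ?u1"
    by (rule mat) (simp_all add: lins Wc XW RW la lin_simps[OF lR] scale_right_distrib,
      simp_all add: algebra_simps)
  moreover have "quadratic_on a2 b2 Q ?u2"
    by (rule mat) (simp_all add: lins Wc YW la algebra_simps)
  moreover have "quadratic_on a3 b3 Q ?u3"
  proof (rule mat)
    show "A (- R z) + - R ((a3 + b3) *s z - A z) = (a3 + b3) *s - R z" for z
      by (simp add: la lin_simps[OF lR] AR algebra_simps)
    show "A (A z) + - R z = (a3 + b3) *s A z - (a3 * b3) *s z" for z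
      by (simp add: R_def algebra_simps)
    show "- R z + ((a3 + b3) *s ((a3 + b3) *s z - A z) - A ((a3 + b3) *s z - A z))
       = (a3 + b3) *s ((a3 + b3) *s z - A z) - (a3 * b3) *s z" for z
      by (simp add: R_def la algebra_simps)
    show "- R z \<in> W" if "z \<in> W" for z using subspace_neg[OF W(1) RW[OF that]] .
  qed (simp_all add: lA lins AW Wc)
  moreover have "?u1 v + ?u2 v + ?u3 v = u (Q v)" for v
  proof -
    \<comment> \<open>The trace hypothesis determines the lower right block: after removing
      \<open>b1 + b2\<close>, exactly \<open>(a3 + b3) *s z - A z\<close> remains.\<close>
    have D: "q (u (e' z)) = (a1 + b1 + a2 + b2 + a3 + b3) *s z - p (u (e z))" if "z \<in> W" for z
      using trace[OF that] by (simp add: algebra_simps)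
    have "u (Q v) = Q (u (e (p v))) + Q (u (e' (q v)))"
      by (simp add: stable Wc ls Q[of v])
    also have "\<dots> = e (p (u (e (p v)))) + e' (Y (p v)) + (e (X (q v)) + e' (q (u (e' (q v)))))"
      by (simp add: Q X_def Y_def)
    also have "\<dots> = e (A (p v) + (a1 + a2) *s p v + X (q v))
        + e' (Y (p v) + ((b1 + b2 + a3 + b3) *s q v - A (q v)))"
      unfolding D[OF W(3)] by (simp add: A_def ls algebra_simps)
    also have "\<dots> = ?u1 v + ?u2 v + ?u3 v"
      by (simp add: mat_def ls algebra_simps)
    finally show ?thesis by simp
  qed
  ultimately show ?thesis unfolding sum3_on_def by blast
qed

section \<open>Pairs of isomorphic coordinate subspaces\<close>

text \<open>Sending \<open>w i\<close> to \<open>k i\<close> identifies the two spans: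
  \<open>j\<close> goes forward, \<open>q\<close> back, and \<open>P\<close> projects onto the first
  span. These are coordinates for \<open>sum3_on_trace\<close>, with the inclusion as first
  embedding.\<close>

lemma pair_coordinates:
  assumes B: "independent B" "span B = UNIV" and w: "inj_on w I" "w ` I \<subseteq> B" and k: "inj_on k I" "k ` I \<subseteq> B"
    and wk: "w ` I \<inter> k ` I = {}"
  obtains P q j where "lin P" "lin q" "lin j"
    and "\<And>z. z \<in> span (w ` I) \<Longrightarrow> P z = z" "\<And>z. z \<in> span (w ` I) \<Longrightarrow> q z = 0"
    and "\<And>z. z \<in> span (w ` I) \<Longrightarrow> P (j z) = 0" "\<And>z. z \<in> span (w ` I) \<Longrightarrow> q (j z) = z"
    and "\<And>i. i \<in> I \<Longrightarrow> j (w i) = k i"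
    and "\<And>v. P v \<in> span (w ` I)" "\<And>v. q v \<in> span (w ` I)"
    and "\<And>b. b \<in> B - w ` I - k ` I \<Longrightarrow> P b = 0" "\<And>b. b \<in> B - w ` I - k ` I \<Longrightarrow> q b = 0"
proof -
  obtain P where P: "lin P" "\<And>b. b \<in> B \<Longrightarrow> P b = (if b \<in> w ` I then b else 0)"
    by (rule lin_extend[OF B(1), where h = "\<lambda>b. if b \<in> w ` I then b else 0"]) blast
  obtain q where q: "lin q" "\<And>b. b \<in> B \<Longrightarrow> q b = (if b \<in> k ` I then w (inv_into I k b) else 0)"
    by (rule lin_extend[OF B(1), where h = "\<lambda>b. if b \<in> k ` I then w (inv_into I k b) else 0"]) blast
  obtain j where j: "lin j" "\<And>b. b \<in> B \<Longrightarrow> j b = (if b \<in> w ` I then k (inv_into I w b) else 0)"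
    by (rule lin_extend[OF B(1), where h = "\<lambda>b. if b \<in> w ` I then k (inv_into I w b) else 0"]) blast
  have wB: "w i \<in> B" and kB: "k i \<in> B" and kw: "k i \<notin> w ` I" and wk': "w i \<notin> k ` I"
    if "i \<in> I" for i using that w k wk by auto
  have jw: "j (w i) = k i" if "i \<in> I" for i using that w by (simp add: j(2) wB)
  have qk: "q (k i) = w i" if "i \<in> I" for i using that k by (simp add: q(2) kB)
  have qw: "q (w i) = 0" if "i \<in> I" for i using that by (simp add: q(2) wB wk')
  have Pw: "P (w i) = w i" if "i \<in> I" for i using that by (simp add: P(2) wB)
  have Pk: "P (k i) = 0" if "i \<in> I" for i using that by (simp add: P(2) kB kw)
  note ls = lin_simps[OF P(1)] lin_simps[OF q(1)] lin_simps[OF j(1)]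
  have l0: "lin (\<lambda>z. z)" "lin (\<lambda>z. 0)" "lin (\<lambda>z. P (j z))" "lin (\<lambda>z. q (j z))"
    by (rule linI; simp add: ls)+
  show thesis
  proof (rule that[of P q j])
    fix z assume z: "z \<in> span (w ` I)"
    show "P z = z" by (rule lin_eq_on_span[OF P(1) l0(1) z]) (auto simp: Pw)
    show "q z = 0" by (rule lin_eq_on_span[OF q(1) l0(2) z]) (auto simp: qw)
    show "P (j z) = 0" by (rule lin_eq_on_span[OF l0(3) l0(2) z]) (auto simp: jw Pk)
    show "q (j z) = z" by (rule lin_eq_on_span[OF l0(4) l0(1) z]) (auto simp: jw qk)
  next
    fix v have v: "v \<in> span B" by (simp add: B(2))
    show "P v \<in> span (w ` I)"
      by (rule lin_span_mem[OF P(1) v]) (auto simp: P(2) span_zero intro: span_base)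
    show "q v \<in> span (w ` I)"
      by (rule lin_span_mem[OF q(1) v]) (auto simp: q(2) span_zero intro!: span_base inv_into_into)
  qed (auto simp: P q j jw inv_into_into)
qed

text \<open>Both sides are linear and agree on \<open>B\<close>. This puts the projection onto the
  two spans into the form that \<open>sum3_on_trace\<close> requires.\<close>

lemma pair_projection:
  assumes B: "independent B" "span B = UNIV"
    and Pqj: "lin P" "lin q" "lin j"
      "\<And>z. z \<in> span (w ` I) \<Longrightarrow> P z = z" "\<And>z. z \<in> span (w ` I) \<Longrightarrow> q z = 0"
      "\<And>z. z \<in> span (w ` I) \<Longrightarrow> P (j z) = 0" "\<And>z. z \<in> span (w ` I) \<Longrightarrow> q (j z) = z"
    and jw: "\<And>i. i \<in> I \<Longrightarrow> j (w i) = k i"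
    and Pq0: "\<And>b. b \<in> B - w ` I - k ` I \<Longrightarrow> P b = 0" "\<And>b. b \<in> B - w ` I - k ` I \<Longrightarrow> q b = 0"
    and Q: "lin Q" "\<And>i. i \<in> I \<Longrightarrow> Q (w i) = w i" "\<And>i. i \<in> I \<Longrightarrow> Q (k i) = k i"
      "\<And>b. b \<in> B - w ` I - k ` I \<Longrightarrow> Q b = 0"
  shows "Q v = P v + j (q v)"
proof -
  note ls = lin_simps[OF Pqj(1)] lin_simps[OF Pqj(2)] lin_simps[OF Pqj(3)]
  have l0: "lin (\<lambda>v. P v + j (q v))" by (rule linI) (simp_all add: ls algebra_simps)
  have wW: "w i \<in> span (w ` I)" if "i \<in> I" for i using that by (auto intro: span_base)
  show ?thesis
  proof (rule lin_eq_on_span[OF Q(1) l0, of _ B])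
      fix b assume "b \<in> B"
      then consider i where "i \<in> I" "b = w i" | i where "i \<in> I" "b = k i" | "b \<in> B - w ` I - k ` I"
        by blast
      then show "Q b = P b + j (q b)"
      proof cases
        case 1 then show ?thesis using wW by (simp add: Q Pqj ls)
      next
        case 2
        then have "Q b = b" "b = j (w i)" by (simp_all add: Q jw)
        then show ?thesis using wW[OF 2(1)] by (simp add: Pqj ls)
      next
        case 3 then show ?thesis by (simp add: Q Pq0 ls)
      qed
  qed (simp add: B)
qed

text \<open>In the paired coordinates \<open>u\<close> is the block matrix diag(l, l), of formal
  trace \<open>2 * l\<close>.\<close>

lemma sum3_on_double:
  assumes B: "independent B" "span B = UNIV"
    and w: "inj_on w I" "w ` I \<subseteq> B" and k: "inj_on k I" "k ` I \<subseteq> B" and wk: "w ` I \<inter> k ` I = {}"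
    and Q: "lin Q" "\<And>i. i \<in> I \<Longrightarrow> Q (w i) = w i" "\<And>i. i \<in> I \<Longrightarrow> Q (k i) = k i"
      "\<And>b. b \<in> B - w ` I - k ` I \<Longrightarrow> Q b = 0"
    and u: "lin u" "\<And>i. i \<in> I \<Longrightarrow> u (w i) = l *s w i" "\<And>i. i \<in> I \<Longrightarrow> u (k i) = l *s k i"
    and l: "2 * l = a1 + b1 + a2 + b2 + a3 + b3"
  shows "sum3_on a1 b1 a2 b2 a3 b3 Q u"
proof -
  let ?W = "span (w ` I)"
  obtain P q j where Pqj: "lin P" "lin q" "lin j"
    "\<And>z. z \<in> ?W \<Longrightarrow> P z = z" "\<And>z. z \<in> ?W \<Longrightarrow> q z = 0"
    "\<And>z. z \<in> ?W \<Longrightarrow> P (j z) = 0" "\<And>z. z \<in> ?W \<Longrightarrow> q (j z) = z"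
    and jw: "\<And>i. i \<in> I \<Longrightarrow> j (w i) = k i"
    and W: "\<And>v. P v \<in> ?W" "\<And>v. q v \<in> ?W"
    and Pq0: "\<And>b. b \<in> B - w ` I - k ` I \<Longrightarrow> P b = 0" "\<And>b. b \<in> B - w ` I - k ` I \<Longrightarrow> q b = 0"
    by (rule pair_coordinates[OF B w k wk]) blast
  note ls = lin_simps[OF Pqj(1)] lin_simps[OF Pqj(2)] lin_simps[OF Pqj(3)] lin_simps[OF u(1)]
  have l0: "lin (\<lambda>z. z)" "lin (\<lambda>z. l *s z)" "lin (\<lambda>z. u (j z))" "lin (\<lambda>z. l *s j z)"
    by (rule linI; simp add: ls algebra_simps)+
  have Qv: "Q v = P v + j (q v)" for v
    by (rule pair_projection[OF B Pqj jw Pq0 Q])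
  have uW: "u z = l *s z" "u (j z) = l *s j z" if z: "z \<in> ?W" for z
    by (rule lin_eq_on_span[OF u(1) l0(2) z] lin_eq_on_span[OF l0(3,4) z]; auto simp: u jw)+
  show ?thesis
  proof (rule sum3_on_trace[OF Pqj(1,2) l0(1) Pqj(3) u(1) subspace_span W Pqj(4-7) Qv])
    show "Q (u z) = u z" "Q (u (j z)) = u (j z)" if "z \<in> ?W" for z
      using that by (simp_all add: uW Qv ls Pqj)
    show "P (u z) + q (u (j z)) = (a1 + b1 + a2 + b2 + a3 + b3) *s z" if "z \<in> ?W" for z
      using that l[symmetric] by (simp add: uW ls Pqj flip: scale_left_distrib)
  qed
qed

text \<open>On the span of the \<open>w\<close> and the \<open>k\<close>, the matrix of \<open>u - l\<close> is \<open>[[P \<circ> u - l, 0], [S, 0]]\<close> with \<open>S\<close>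
  the shift. Replacing \<open>k\<close> by \<open>k + \<chi> k\<close> adds \<open>S \<chi> - \<chi> S\<close> to the trace, and every operator is
  such a commutator: \<open>\<chi> S = \<delta> + S \<chi>\<close> is a recursion along the shift.\<close>

lemma sum3_on_shift:
  fixes w k :: "'i \<times> nat \<Rightarrow> 'b" and Y :: "'i set"
  defines "I \<equiv> Y \<times> UNIV"
  assumes B: "independent B" "span B = UNIV"
    and w: "inj_on w I" "w ` I \<subseteq> B" and k: "inj_on k I" "k ` I \<subseteq> B" and wk: "w ` I \<inter> k ` I = {}"
    and Q: "lin Q" "\<And>i. i \<in> I \<Longrightarrow> Q (w i) = w i" "\<And>i. i \<in> I \<Longrightarrow> Q (k i) = k i"
      "\<And>b. b \<in> B - w ` I - k ` I \<Longrightarrow> Q b = 0"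
    and u: "lin u"
      "\<And>y n. y \<in> Y \<Longrightarrow> u (w (y, n)) - l *s w (y, n) - k (y, Suc n) \<in> span (w ` I)"
      "\<And>i. i \<in> I \<Longrightarrow> u (k i) = l *s k i"
  shows "sum3_on a1 b1 a2 b2 a3 b3 Q u"
proof -
  let ?W = "span (w ` I)"
  obtain P q j where Pqj: "lin P" "lin q" "lin j"
    "\<And>z. z \<in> ?W \<Longrightarrow> P z = z" "\<And>z. z \<in> ?W \<Longrightarrow> q z = 0"
    "\<And>z. z \<in> ?W \<Longrightarrow> P (j z) = 0" "\<And>z. z \<in> ?W \<Longrightarrow> q (j z) = z"
    and jw: "\<And>i. i \<in> I \<Longrightarrow> j (w i) = k i"
    and W: "\<And>v. P v \<in> ?W" "\<And>v. q v \<in> ?W"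
    and Pq0: "\<And>b. b \<in> B - w ` I - k ` I \<Longrightarrow> P b = 0" "\<And>b. b \<in> B - w ` I - k ` I \<Longrightarrow> q b = 0"
    by (rule pair_coordinates[OF B w k wk]) blast
  note ls = lin_simps[OF Pqj(1)] lin_simps[OF Pqj(2)] lin_simps[OF Pqj(3)] lin_simps[OF u(1)]
  have iw: "independent (w ` I)" using independent_mono[OF B(1) w(2)] .
  have wW: "w i \<in> ?W" if "i \<in> I" for i using that by (auto intro: span_base)
  obtain S where S: "lin S" "\<And>b. b \<in> w ` I \<Longrightarrow>
      S b = (case inv_into I w b of (y, n) \<Rightarrow> w (y, Suc n))"
    by (rule lin_extend[OF iw, where h = "\<lambda>b. case inv_into I w b of (y, n) \<Rightarrow> w (y, Suc n)"]) blast
  have Sw: "S (w (y, n)) = w (y, Suc n)" if "y \<in> Y" for y n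
    using that w(1) by (simp add: S(2) I_def)
  have SW: "S z \<in> ?W" if "z \<in> ?W" for z
    by (rule lin_span_mem[OF S(1) that]) (auto simp: I_def Sw intro!: span_base)
  define t where "t = a1 + b1 + a2 + b2 + a3 + b3"
  \<comment> \<open>The diagonal blocks of \<open>u\<close> are P u and \<open>l\<close>, so
    \<open>\<delta>\<close> is the excess of the formal trace over \<open>t\<close>, which the
    commutator has to cancel.\<close>
  define \<delta> where "\<delta> z = P (u z) - (t - l) *s z" for z
  have \<delta>W: "\<delta> z \<in> ?W" if "z \<in> ?W" for z
    using that by (simp add: \<delta>_def span_diff span_scale W)
  \<comment> \<open>At \<open>w (y, n)\<close> the equation \<chi> S = \<delta> + S \<chi>
    prescribes the value of \<chi> at \<open>w (y, Suc n)\<close>. Nothing constrains index 0, where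
    the value is set to 0.\<close>
  define x where "x y = rec_nat 0 (\<lambda>n r. \<delta> (w (y, n)) + S r)" for y
  have xW: "x y n \<in> ?W" if "y \<in> Y" for y n
  proof (induction n)
    case (Suc n)
    have "w (y, n) \<in> ?W" by (rule wW) (simp add: I_def that)
    then show ?case using Suc by (simp add: x_def span_add SW \<delta>W)
  qed (simp add: x_def span_zero)
  obtain \<chi> where \<chi>: "lin \<chi>" "\<And>b. b \<in> w ` I \<Longrightarrow> \<chi> b = (case inv_into I w b of (y, n) \<Rightarrow> x y n)"
    by (rule lin_extend[OF iw, where h = "\<lambda>b. case inv_into I w b of (y, n) \<Rightarrow> x y n"]) blast
  have \<chi>w: "\<chi> (w (y, n)) = x y n" if "y \<in> Y" for y n
    using that w(1) by (simp add: \<chi>(2) I_def)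
  have \<chi>W: "\<chi> z \<in> ?W" if "z \<in> ?W" for z
    by (rule lin_span_mem[OF \<chi>(1) that]) (auto simp: I_def \<chi>w intro!: xW[unfolded I_def])
  note ls = ls lin_simps[OF S(1)] lin_simps[OF \<chi>(1)]
  have l\<delta>: "lin \<delta>" by (rule linI) (simp_all add: \<delta>_def ls algebra_simps)
  have l: "lin (\<lambda>z. z)" "lin (\<lambda>z. l *s j z)" "lin (\<lambda>z. u (j z))"
    "lin (\<lambda>z. P (u z) + j (S z))" "lin (\<lambda>z. \<chi> (S z))" "lin (\<lambda>z. \<delta> z + S (\<chi> z))"
    "lin (\<lambda>v. P v - \<chi> (q v))" "lin (\<lambda>z. j z + \<chi> z)"
    by (rule linI; simp add: ls lin_simps[OF l\<delta>] algebra_simps)+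
  have commutator: "\<chi> (S z) = \<delta> z + S (\<chi> z)" if "z \<in> ?W" for z
    by (rule lin_eq_on_span[OF l(5,6) that]) (auto simp: I_def Sw \<chi>w x_def)
  have uj: "u (j z) = l *s j z" if "z \<in> ?W" for z
    by (rule lin_eq_on_span[OF l(3,2) that]) (auto simp: jw u(3))
  \<comment> \<open>The component of \<open>u z\<close> outside \<open>?W\<close> is
    \<open>j (S z)\<close>, since \<open>w (y, n)\<close> contributes \<open>k (y, Suc n)\<close>,
    which is \<open>j\<close> of the shifted vector.\<close>
  have uz: "u z = P (u z) + j (S z)" if "z \<in> ?W" for z
  proof (rule lin_eq_on_span[OF u(1) l(4) that])
    fix b assume "b \<in> w ` I"
    then obtain y n where b: "y \<in> Y" "b = w (y, n)" "b \<in> ?W" "w (y, Suc n) \<in> ?W"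
      using wW by (force simp: I_def)
    have k': "k (y, Suc n) = j (w (y, Suc n))" using b(1) by (simp add: jw I_def)
    have "u b - k (y, Suc n) \<in> ?W"
      using span_add[OF u(2)[OF b(1), of n] span_scale[OF b(3), of l]] b(2) by (simp add: algebra_simps)
    then have "P (u b - k (y, Suc n)) = u b - k (y, Suc n)" by (rule Pqj(4))
    then show "u b = P (u b) + j (S b)"
      using b by (simp add: ls k' Pqj(6) Sw[OF b(1)] algebra_simps)
  qed
  have Qv: "Q v = P v + j (q v)" for v
    by (rule pair_projection[OF B Pqj jw Pq0 Q])
  have qu: "q (u z) = S z" if "z \<in> ?W" for z
    using uz[OF that] Pqj(5)[OF W(1)] Pqj(7)[OF SW[OF that]] by (metis add_0 ls(6))
  \<comment> \<open>The new complement consists of the vectors \<open>j z + \<chi> z\<close>;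
    expressing \<open>P v + j (q v)\<close> through it leaves \<open>P v - \<chi> (q v)\<close> as
    first coordinate.\<close>
  show ?thesis
  proof (rule sum3_on_trace[where p = "\<lambda>v. P v - \<chi> (q v)" and q = q and e = "\<lambda>z. z"
        and e' = "\<lambda>z. j z + \<chi> z" and W = ?W])
    have Q1: "Q (u z) = u z" if "z \<in> ?W" for z
      using uz[OF that] by (simp add: Qv qu that)
    show "Q (u z) = u z" if "z \<in> ?W" for z using Q1[OF that] .
    show "Q (u (j z + \<chi> z)) = u (j z + \<chi> z)" if "z \<in> ?W" for z
    proof -
      have "Q (l *s j z) = l *s j z" using that by (simp add: Qv ls Pqj)
      then show ?thesis by (simp add: ls lin_simps[OF Q(1)] uj that Q1 \<chi>W)
    qed
    show "P (u z) - \<chi> (q (u z)) + q (u (j z + \<chi> z)) = (a1 + b1 + a2 + b2 + a3 + b3) *s z"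
      if "z \<in> ?W" for z
      using that commutator[OF that] unfolding t_def[symmetric]
      by (simp add: ls qu uj \<chi>W Pqj \<delta>_def algebra_simps)
  qed (simp_all add: l Pqj u(1) W span_diff \<chi>W Qv ls)
qed

section \<open>Bases adapted to an operator of small rank\<close>

text \<open>If a vector of \<open>A\<close> equals x + y with x, y in the spans of the other vectors
  of \<open>A\<close> and \<open>M\<close>, then y lies in both spans, so it vanishes and
  \<open>A\<close> would be dependent; \<open>M\<close> is symmetric.\<close>

lemma independent_Un:
  assumes A: "independent A" and M: "independent M"
    and AM: "\<And>x. x \<in> span A \<Longrightarrow> x \<in> span M \<Longrightarrow> x = 0"
  shows "independent (A \<union> M)"
proof -
  have *: False if A: "independent A" and AM: "\<And>x. x \<in> span A \<Longrightarrow> x \<in> span M \<Longrightarrow> x = 0"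
    and a: "a \<in> A" "a \<in> span (A \<union> M - {a})" for A M a
  proof -
    have "a \<in> span ((A - {a}) \<union> (M - {a}))" using a(2) by (simp add: Un_Diff)
    then obtain x y where xy: "x \<in> span (A - {a})" "y \<in> span (M - {a})" "a = x + y"
      unfolding span_Un by blast
    then have "x \<in> span A" "y \<in> span M" using span_mono[of "A - {a}" A] span_mono[of "M - {a}" M] by auto
    moreover have "y = a - x" using xy by simp
    ultimately have "y = 0" using AM span_diff[OF span_base[OF a(1)]] by blast
    then show False using xy a(1) A by (auto simp: dependent_def)
  qed
  show ?thesis
  proof
    assume "dependent (A \<union> M)"
    then obtain a where a: "a \<in> A \<union> M" "a \<in> span (A \<union> M - {a})" by (auto simp: dependent_def)
    from a(1) show False
    proof
      assume "a \<in> A" from *[OF A AM this a(2)] show False .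
    next
      assume "a \<in> M" from *[OF M AM[rotated] this a(2)[unfolded Un_commute[of A]]] show False .
    qed
  qed
qed

lemma lin_independent_image:
  assumes "lin f" "independent B" "\<And>z. z \<in> span B \<Longrightarrow> f z = 0 \<Longrightarrow> z = 0"
  shows "independent (f ` B)" "inj_on f (span B)"
proof -
  interpret vector_space_pair scale scale by unfold_locales
  show "inj_on f (span B)"
    using assms by (subst linear_inj_on_iff_eq_0) auto
  then show "independent (f ` B)"
    using linear_independent_injective_image[OF assms(1,2)] by blast
qed

lemma card_of_bases:
  assumes "independent B" "independent C" "span B = span C"
  shows "|B| =o |C|"
  using bij_if_span_eq_span_bases[OF assms] card_of_ordIso by blast

text \<open>A basis of the span of \<open>S\<close> taken from \<open>S\<close> is extended by
  vectors of \<open>K\<close> to a basis of the space. If fewer than \<open>|R|\<close> vectors were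
  added, the whole basis would have size at most \<open>|R|\<close>, which is less than
  \<open>|C|\<close>.\<close>

lemma basis_mod_small_subspace:
  assumes R: "infinite R" and S: "|S| \<le>o |R|" and C: "independent C" "span C = UNIV" "|R| <o |C|"
    and K: "span (S \<union> K) = UNIV"
  obtains B D where "independent (B \<union> D)" "B \<inter> D = {}" "D \<subseteq> K" "span S \<subseteq> span B" "|R| \<le>o |D|"
proof -
  obtain B where B: "B \<subseteq> S" "independent B" "S \<subseteq> span B"
    using maximal_independent_subset .
  have "B \<subseteq> B \<union> K" by blast
  then obtain B1 where B1: "B \<subseteq> B1" "B1 \<subseteq> B \<union> K" "independent B1" "B \<union> K \<subseteq> span B1"
    using maximal_independent_subset_extend[OF _ B(2)] by blast
  have "S \<subseteq> span B1" using B(3) span_mono[OF B1(1)] by blast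
  then have "span B1 = UNIV"
    using K B1(4) span_mono[of "S \<union> K" "span B1"] by (simp add: span_span top.extremum_unique)
  then have "|C| =o |B1|" using card_of_bases[OF C(1) B1(3)] C(2) by simp
  have "|R| \<le>o |B1 - B|"
  proof (rule ccontr)
    assume "\<not> |R| \<le>o |B1 - B|"
    then have "|B1 - B| \<le>o |R|" using ordLeq_total[OF card_of_Well_order[of R] card_of_Well_order[of "B1 - B"]] by blast
    moreover have "|B| \<le>o |R|" using ordLeq_transitive[OF card_of_mono1[OF B(1)] S] .
    ultimately have "|B \<union> (B1 - B)| \<le>o |R|" by (intro card_of_Un_ordLeq_infinite[OF R])
    then have "|B1| \<le>o |R|" using B1(1) by (simp add: Un_absorb1)
    from ordIso_ordLeq_trans[OF \<open>|C| =o |B1|\<close> this] show False using C(3) not_ordLess_ordLeq by blast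
  qed
  then show thesis
    using B1 B(3) by (intro that[of B "B1 - B"]) (auto simp: Un_absorb1 span_minimal)
qed

text \<open>The vectors \<open>T b = s b + \<theta> b\<close> span a complement of the kernel of \<open>g\<close>. As \<open>\<theta> b\<close> is a kernel vector
  foreign to everything else, the kernel component \<open>\<alpha>\<close> of \<open>g \<circ> T\<close> is injective even where \<open>g\<close>
  maps into the span of the \<open>s b\<close>.\<close>

lemma shift_normal_form:
  assumes g: "lin g" and R: "independent R" "span R = range g" "infinite R"
    and C: "independent C" "span C = UNIV" "|R| <o |C|"
  obtains B and w k :: "'b \<times> nat \<Rightarrow> 'b"
  where "independent B" "span B = UNIV"
    and "inj_on w (R \<times> UNIV)" "w ` (R \<times> UNIV) \<subseteq> B" "inj_on k (R \<times> UNIV)" "k ` (R \<times> UNIV) \<subseteq> B"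
    and "w ` (R \<times> UNIV) \<inter> k ` (R \<times> UNIV) = {}"
    and "\<And>y n. y \<in> R \<Longrightarrow> g (w (y, n)) - k (y, Suc n) \<in> span (w ` (R \<times> UNIV))"
    and "\<And>i. i \<in> R \<times> UNIV \<Longrightarrow> g (k i) = 0"
    and "\<And>b. b \<in> B - w ` (R \<times> UNIV) - k ` (R \<times> UNIV) \<Longrightarrow> g b = 0"
    and "infinite (B - w ` (R \<times> UNIV) - k ` (R \<times> UNIV))"
proof -
  let ?I = "R \<times> (UNIV :: nat set)"
  define K where "K = {v. g v = 0}"
  note lg = lin_simps[OF g]
  have lid: "lin (\<lambda>z. z)" and l0: "lin (\<lambda>z. 0)" by (rule linI; simp)+
  have gR: "g v \<in> span R" for v by (simp add: R(2))
  have RR: "b \<in> range g" if "b \<in> R" for b using span_base[OF that] R(2) by simp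
  obtain s where s: "lin s" "\<And>b. b \<in> R \<Longrightarrow> s b = inv g b"
    by (rule lin_extend[OF R(1), where h = "inv g"]) blast
  have lgs: "lin (\<lambda>z. g (s z))" by (rule linI) (simp_all add: lg lin_simps[OF s(1)])
  have gs: "g (s z) = z" if "z \<in> span R" for z
    by (rule lin_eq_on_span[OF lgs lid that]) (simp add: s(2) f_inv_into_f[OF RR])
  \<comment> \<open>The span of \<open>?S\<close> contains the range of \<open>g\<close> and its
    lift by the section \<open>s\<close>. With the kernel it fills the space, as \<open>v\<close> is
    \<open>s (g v)\<close> plus a kernel vector.\<close>
  let ?S = "R \<union> s ` R"
  have sR: "s z \<in> span ?S" if "z \<in> span R" for z
    by (rule lin_span_mem[OF s(1) that]) (auto intro: span_base)
  have RS: "z \<in> span ?S" if "z \<in> span R" for z using span_mono[of R ?S] that by blast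
  have "|?S| \<le>o |R|"
    by (intro card_of_Un_ordLeq_infinite[OF R(3)] card_of_image ordLeq_reflexive card_of_Well_order)
  moreover have "v \<in> span (?S \<union> K)" for v
  proof -
    have "s (g v) \<in> span (?S \<union> K)" using sR[OF gR] span_mono[of ?S "?S \<union> K"] by blast
    moreover have "v - s (g v) \<in> span (?S \<union> K)"
      by (rule span_base) (simp add: K_def lg gs[OF gR])
    ultimately show ?thesis using span_add by fastforce
  qed
  then have "span (?S \<union> K) = UNIV" by blast
  ultimately obtain B1 D where D: "independent (B1 \<union> D)" "B1 \<inter> D = {}" "D \<subseteq> K"
      "span ?S \<subseteq> span B1" "|R| \<le>o |D|"
    by (rule basis_mod_small_subspace[OF R(3) _ C]) blast
  have "|R <+> R| \<le>o |D|"
    using ordIso_ordLeq_trans[OF card_of_Plus_infinite1[OF R(3) ordLeq_reflexive[OF card_of_Well_order]] D(5)] .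
  then obtain f where f: "inj_on f (R <+> R)" "f ` (R <+> R) \<subseteq> D"
    unfolding card_of_ordLeq[symmetric] by blast
  \<comment> \<open>Two disjoint copies of \<open>R\<close> inside the kernel: the
    \<open>e b\<close> twist the section \<open>s\<close> through \<theta>, and the
    \<open>c b\<close> become the initial vectors of the family \<open>k\<close>.\<close>
  define e where "e b = f (Inl b)" for b
  define c where "c b = f (Inr b)" for b
  have eD: "e b \<in> D" and cD: "c b \<in> D" if "b \<in> R" for b
    using f(2) that by (auto simp: e_def c_def)
  have inje: "inj_on e R" and injc: "inj_on c R"
    using f(1) by (auto simp: inj_on_def e_def c_def)
  have ec: "e b \<noteq> c b'" if "b \<in> R" "b' \<in> R" for b b'
    using f(1) that by (auto simp: inj_on_def e_def c_def)
  obtain \<theta> where \<theta>: "lin \<theta>" "\<And>b. b \<in> R \<Longrightarrow> \<theta> b = e b"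
    by (rule lin_extend[OF R(1), where h = e]) blast
  \<comment> \<open>\<open>\<rho>\<close> reads off the \<open>e\<close> coordinates, inverting
    \<theta> on the range of \<open>g\<close>, and \<open>\<kappa>\<close> the \<open>c\<close>
    coordinates; both vanish on the span of \<open>?S\<close>.\<close>
  obtain \<rho> where \<rho>: "lin \<rho>" "\<And>b. b \<in> B1 \<union> D \<Longrightarrow> \<rho> b = (if b \<in> e ` R then inv_into R e b else 0)"
    by (rule lin_extend[OF D(1), where h = "\<lambda>b. if b \<in> e ` R then inv_into R e b else 0"]) blast
  obtain \<kappa> where \<kappa>: "lin \<kappa>" "\<And>b. b \<in> B1 \<union> D \<Longrightarrow> \<kappa> b = (if b \<in> c ` R then b else 0)"
    by (rule lin_extend[OF D(1), where h = "\<lambda>b. if b \<in> c ` R then b else 0"]) blast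
  note ls = lg lin_simps[OF s(1)] lin_simps[OF \<theta>(1)] lin_simps[OF \<rho>(1)] lin_simps[OF \<kappa>(1)]
  have l\<rho>\<theta>: "lin (\<lambda>z. \<rho> (\<theta> z))" and lg\<theta>: "lin (\<lambda>z. g (\<theta> z))" by (rule linI; simp add: ls)+
  have \<rho>\<theta>: "\<rho> (\<theta> z) = z" if "z \<in> span R" for z
    by (rule lin_eq_on_span[OF l\<rho>\<theta> lid that]) (simp add: \<theta>(2) \<rho>(2) eD inje)
  have g\<theta>: "g (\<theta> z) = 0" if "z \<in> span R" for z
    by (rule lin_eq_on_span[OF lg\<theta> l0 that]) (use \<theta>(2) eD D(3) in \<open>auto simp: K_def\<close>)
  have \<rho>S: "\<rho> z = 0" if "z \<in> span ?S" for z
    by (rule lin_eq_on_span[OF \<rho>(1) l0 subsetD[OF D(4) that]]) (use \<rho>(2) eD D(2) in auto)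
  have \<kappa>S: "\<kappa> z = 0" if "z \<in> span ?S" for z
    by (rule lin_eq_on_span[OF \<kappa>(1) l0 subsetD[OF D(4) that]]) (use \<kappa>(2) cD D(2) in auto)
  have \<rho>c: "\<rho> y = 0" if "y \<in> span (c ` R)" for y
    by (rule lin_eq_on_span[OF \<rho>(1) l0 that]) (use \<rho>(2) cD ec in fastforce)
  have \<kappa>c: "\<kappa> y = y" if "y \<in> span (c ` R)" for y
    by (rule lin_eq_on_span[OF \<kappa>(1) lid that]) (use \<kappa>(2) cD in auto)
  define T where "T z = s z + \<theta> z" for z
  \<comment> \<open>\<open>T\<close> is again a section of \<open>g\<close> over its range, so
    \<open>\<alpha> z\<close> is the kernel component of \<open>z\<close> along the image of that
    section.\<close>
  define \<alpha> where "\<alpha> z = z - T (g z)" for z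
  have lT: "lin T" and l\<alpha>: "lin \<alpha>" by (rule linI; simp add: T_def \<alpha>_def ls algebra_simps)+
  have gT: "g (T z) = z" if "z \<in> span R" for z using that by (simp add: T_def ls gs g\<theta>)
  have g\<alpha>: "g (\<alpha> z) = 0" for z by (simp add: \<alpha>_def ls gT gR)
  \<comment> \<open>\<open>\<rho>\<close> maps \<open>\<alpha> z\<close> to \<open>- g z\<close>, so
    \<open>g z = 0\<close> and \<open>\<alpha> z = z\<close>; then \<open>\<kappa>\<close> both
    fixes and kills \<open>z\<close>. This gives the injectivity of \<alpha> on the range of
    \<open>g\<close> and the independence of its values from the \<open>c b\<close>.\<close>
  have \<alpha>c: "\<alpha> z = 0 \<and> z = 0" if z: "z \<in> span R" "\<alpha> z \<in> span (c ` R)" for z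
  proof -
    have "\<rho> (\<alpha> z) = - g z"
      using z(1) by (simp add: \<alpha>_def T_def ls \<rho>S RS sR gR \<rho>\<theta>)
    then have "g z = 0" using \<rho>c[OF z(2)] by simp
    then have "\<alpha> z = z" by (simp add: \<alpha>_def T_def ls)
    then show ?thesis using \<kappa>c[OF z(2)] \<kappa>S[OF RS[OF z(1)]] by simp
  qed
  have c: "independent (c ` R)" using independent_mono[OF D(1)] cD by blast
  have T: "independent (T ` R)" "inj_on T (span R)"
    using lin_independent_image[OF lT R(1)] gT lg(5) by metis+
  have \<alpha>: "independent (\<alpha> ` R)" "inj_on \<alpha> (span R)"
    using lin_independent_image[OF l\<alpha> R(1)] \<alpha>c span_zero by metis+
  have span_\<alpha>: "\<exists>z\<in>span R. x = \<alpha> z" if "x \<in> span (\<alpha> ` R)" for x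
    using that module_hom.span_image[OF l\<alpha>[folded module_hom_iff_linear]] by auto
  have span_T: "\<exists>z\<in>span R. x = T z" if "x \<in> span (T ` R)" for x
    using that module_hom.span_image[OF lT[folded module_hom_iff_linear]] by auto
  have N: "independent (\<alpha> ` R \<union> c ` R)"
    using \<alpha>(1) c by (rule independent_Un) (use span_\<alpha> \<alpha>c in blast)
  have NK: "\<alpha> ` R \<union> c ` R \<subseteq> K" using cD D(3) by (auto simp: K_def g\<alpha>)
  \<comment> \<open>A basis of the kernel containing both families; the vectors \<open>T b\<close>
    with \<open>b\<close> in \<open>R\<close> complete it to a basis of the space.\<close>
  obtain M where M: "\<alpha> ` R \<union> c ` R \<subseteq> M" "M \<subseteq> K" "independent M" "K \<subseteq> span M"
    using maximal_independent_subset_extend[OF NK N] .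
  have gM: "g x = 0" if "x \<in> span M" for x
    by (rule lin_eq_on_span[OF g l0 that]) (use M(2) in \<open>auto simp: K_def\<close>)
  have B: "independent (T ` R \<union> M)"
    using T(1) M(3)
  proof (rule independent_Un)
    fix x assume "x \<in> span (T ` R)" "x \<in> span M"
    then show "x = 0" using span_T gM gT lin_simps(5)[OF lT] by metis
  qed
  have "v \<in> span (T ` R \<union> M)" for v
  proof -
    have "T (g v) \<in> span (T ` R \<union> M)"
      by (rule lin_span_mem[OF lT gR]) (auto intro: span_base)
    moreover have "v - T (g v) \<in> K" by (simp add: K_def ls gT gR)
    then have "v - T (g v) \<in> span (T ` R \<union> M)"
      using M(4) span_mono[of M "T ` R \<union> M"] by blast
    ultimately show ?thesis using span_add by fastforce
  qed
  then have spB: "span (T ` R \<union> M) = UNIV" by blast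
  have "|R \<times> (UNIV :: nat set)| =o |R|"
    by (rule card_of_Times_infinite_simps(1)) (use R(3) in \<open>auto simp: infinite_iff_card_of_nat[symmetric]\<close>)
  \<comment> \<open>Re-indexes \<open>R\<close> by pairs, giving one infinite chain for each of its
    elements.\<close>
  then obtain h where h: "bij_betw h ?I R" unfolding card_of_ordIso[symmetric] by blast
  have hR: "h (y, n) \<in> R" if "y \<in> R" for y n using bij_betwE[OF h] that by blast
  have hI: "h ` ?I = R" using h by (simp add: bij_betw_def)
  have RsR: "b \<in> span R" if "b \<in> R" for b using span_base[OF that] .
  define w where "w i = T (h i)" for i
  \<comment> \<open>As \<open>g (w (y, n))\<close> is \<open>h (y, n)\<close>, its kernel component
    is \<open>\<alpha> (h (y, n))\<close>, placed at index \<open>Suc n\<close>. Index 0, which the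
    shift never reaches, receives \<open>c y\<close>.\<close>
  define k where "k i = (case snd i of 0 \<Rightarrow> c (fst i) | Suc n \<Rightarrow> \<alpha> (h (fst i, n)))" for i
  have wI: "w ` ?I = T ` R" using hI by (auto simp: w_def image_image[symmetric])
  have kI: "k i \<in> \<alpha> ` R \<union> c ` R" if "i \<in> ?I" for i
    using that hR by (auto simp: k_def split: nat.split)
  have gk: "g (k i) = 0" if "i \<in> ?I" for i
    using kI[OF that] NK by (auto simp: K_def)
  show thesis
  proof (rule that[of "T ` R \<union> M" w k])
    show "inj_on w ?I"
    proof -
      have "inj_on T (h ` ?I)" using inj_on_subset[OF T(2)] RsR hI by blast
      with h show ?thesis unfolding w_def bij_betw_def using comp_inj_on by (fastforce simp: comp_def)
    qed
    show "inj_on k ?I"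
    proof (rule inj_onI)
      have ca: "c y \<noteq> \<alpha> z" if "y \<in> R" "z \<in> R" for y z
      proof
        assume "c y = \<alpha> z"
        moreover have "c y \<in> span (c ` R)" using that(1) by (auto intro: span_base)
        ultimately have "z = 0" using \<alpha>c[OF RsR[OF that(2)]] by simp
        then show False using that(2) R(1) dependent_zero by blast
      qed
      fix i i' assume i: "i \<in> ?I" "i' \<in> ?I" "k i = k i'"
      obtain y n y' n' where ii: "i = (y, n)" "i' = (y', n')" by (metis surj_pair)
      have y: "y \<in> R" "y' \<in> R" using i ii by auto
      show "i = i'"
      proof (cases n)
        case 0
        then have "n' = 0" using i(3) ca[OF y(1) hR[OF y(2)]] by (cases n') (auto simp: ii k_def)
        then show ?thesis using 0 i(3) injc y by (auto simp: ii k_def inj_on_def)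
      next
        case (Suc m)
        then obtain m' where m': "n' = Suc m'"
          using i(3) ca[OF y(2) hR[OF y(1)], of m] by (cases n') (auto simp: ii k_def)
        then have "\<alpha> (h (y, m)) = \<alpha> (h (y', m'))" using Suc i(3) by (simp add: ii k_def)
        then have "h (y, m) = h (y', m')" using inj_onD[OF \<alpha>(2)] RsR hR y by blast
        then have "(y, m) = (y', m')" using h y by (auto simp: bij_betw_def inj_on_def)
        then show ?thesis using Suc m' by (simp add: ii)
      qed
    qed
    show "k ` ?I \<subseteq> T ` R \<union> M" using kI M(1) by blast
    show "w ` ?I \<inter> k ` ?I = {}"
    proof -
      have False if "b \<in> R" "i \<in> ?I" "T b = k i" for b i
        using gT[OF RsR[OF that(1)]] gk[OF that(2)] that(1,3) R(1) dependent_zero by fastforce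
      then show ?thesis unfolding wI by blast
    qed
    show "g (w (y, n)) - k (y, Suc n) \<in> span (w ` ?I)" if "y \<in> R" for y n
    proof -
      have "g (w (y, n)) = h (y, n)" using gT RsR hR[OF that] by (simp add: w_def)
      then have "g (w (y, n)) - k (y, Suc n) = T (g (h (y, n)))" by (simp add: k_def \<alpha>_def)
      also have "\<dots> \<in> span (T ` R)" by (rule lin_span_mem[OF lT gR]) (auto intro: span_base)
      finally show ?thesis unfolding wI .
    qed
    show "g b = 0" if "b \<in> T ` R \<union> M - w ` ?I - k ` ?I" for b
      using that M(2) by (auto simp: wI K_def)
    \<comment> \<open>With a finite remainder the whole basis would have size at most
      \<open>|R|\<close>, against \<open>|R| <o |C|\<close>.\<close>
    show "infinite (T ` R \<union> M - w ` ?I - k ` ?I)"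
    proof
      assume fin: "finite (T ` R \<union> M - w ` ?I - k ` ?I)"
      have small: "|T ` R \<union> k ` ?I \<union> (T ` R \<union> M - w ` ?I - k ` ?I)| \<le>o |R|"
        using \<open>|?I| =o |R|\<close>
        by (intro card_of_Un_ordLeq_infinite[OF R(3)] card_of_image ordLeq3_finite_infinite[OF fin R(3)]
          ordLeq_ordIso_trans[OF card_of_image])
      have "T ` R \<union> M \<subseteq> T ` R \<union> k ` ?I \<union> (T ` R \<union> M - w ` ?I - k ` ?I)"
        unfolding wI by blast
      from ordLeq_transitive[OF card_of_mono1[OF this] small] have "|T ` R \<union> M| \<le>o |R|" .
      moreover have "|C| =o |T ` R \<union> M|" using card_of_bases[OF C(1) B] C(2) spB by simp
      ultimately have "|C| \<le>o |R|" by (rule ordIso_ordLeq_trans[rotated])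
      then show False using C(3) not_ordLess_ordLeq by blast
    qed
  qed (use B spB wI gk in auto)
qed

section \<open>From the normal form to the theorem\<close>

lemma poly_endo_quadratic:
  assumes "quadratic_on a b (\<lambda>v. v) f" and "degree p = 2" "coeff p 0 = c * (a * b)"
    "coeff p (Suc 0) = - (c * (a + b))" "coeff p 2 = c"
  shows "poly_endo scale p f = (\<lambda>_. 0)"
proof
  fix v
  have "poly_endo scale p f v = (c * (a * b)) *s v + (- (c * (a + b))) *s f v + c *s f (f v)"
    using assms(2-) by (simp add: poly_endo_def numeral_2_eq_2)
  moreover have "f (f v) = (a + b) *s f v - (a * b) *s v"
    using assms(1) by (simp add: quadratic_on_def)
  ultimately show "poly_endo scale p f v = 0" by (simp add: algebra_simps)
qed

lemma sum3_on_dominant: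
  assumes u: "lin u" and R: "independent R" "span R = range (\<lambda>v. u v - l *s v)" "infinite R"
    and C: "independent C" "span C = UNIV" "|R| <o |C|"
    and l: "(\<exists>x1 x2 x3. (x1 = a1 \<or> x1 = b1) \<and> (x2 = a2 \<or> x2 = b2) \<and> (x3 = a3 \<or> x3 = b3) \<and>
      l = x1 + x2 + x3) \<or> 2 * l = a1 + b1 + a2 + b2 + a3 + b3"
  shows "sum3_on a1 b1 a2 b2 a3 b3 (\<lambda>v. v) u"
proof -
  let ?I = "R \<times> (UNIV :: nat set)"
  have "lin (\<lambda>v. u v - l *s v)" by (rule linI) (simp_all add: lin_simps[OF u] algebra_simps)
  then obtain B and w k :: "'b \<times> nat \<Rightarrow> 'b"
    where B: "independent B" "span B = UNIV"
      and w: "inj_on w ?I" "w ` ?I \<subseteq> B" and k: "inj_on k ?I" "k ` ?I \<subseteq> B" and wk: "w ` ?I \<inter> k ` ?I = {}"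
      and uw: "\<And>y n. y \<in> R \<Longrightarrow> u (w (y, n)) - l *s w (y, n) - k (y, Suc n) \<in> span (w ` ?I)"
      and uk: "\<And>i. i \<in> ?I \<Longrightarrow> u (k i) - l *s k i = 0"
      and ub: "\<And>b. b \<in> B - w ` ?I - k ` ?I \<Longrightarrow> u b - l *s b = 0"
      and inf: "infinite (B - w ` ?I - k ` ?I)"
    by (rule shift_normal_form[OF _ R C]) blast
  let ?X = "B - w ` ?I - k ` ?I"
  \<comment> \<open>\<open>Q\<close> projects onto the span of the \<open>w i\<close> and
    \<open>k i\<close> along the span of \<open>?X\<close>, on which \<open>u\<close> is the scalar
    \<open>l\<close>; \<open>Q'\<close> is the complementary projection.\<close>
  obtain Q where Q: "lin Q" "\<And>b. b \<in> B \<Longrightarrow> Q b = (if b \<in> ?X then 0 else b)"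
    by (rule lin_extend[OF B(1), where h = "\<lambda>b. if b \<in> ?X then 0 else b"]) blast
  define Q' where "Q' v = v - Q v" for v
  have lQ': "lin Q'" by (rule linI) (simp_all add: Q'_def lin_simps[OF Q(1)] algebra_simps)
  have lins: "lin (\<lambda>v. Q (Q v))" "lin (\<lambda>v. u (Q' v))" "lin (\<lambda>v. l *s Q' v)"
    by (rule linI; simp add: lin_simps[OF Q(1)] lin_simps[OF lQ'] lin_simps[OF u] algebra_simps)+
  have QQ: "Q (Q v) = Q v" for v
    by (rule lin_eq_on_span[OF lins(1) Q(1), of _ B]) (auto simp: B Q lin_simps(5)[OF Q(1)])
  have main: "sum3_on a1 b1 a2 b2 a3 b3 Q u"
  proof (rule sum3_on_shift[OF B w k wk Q(1) _ _ _ u uw])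
    show "Q (w i) = w i" if "i \<in> ?I" for i
      using Q(2)[OF subsetD[OF w(2) imageI[OF that]]] that by simp
    show "Q (k i) = k i" if "i \<in> ?I" for i
      using Q(2)[OF subsetD[OF k(2) imageI[OF that]]] that by simp
    show "u (k i) = l *s k i" if "i \<in> ?I" for i using uk[OF that] by simp
  qed (use Q(2) in auto)
  have Q'X: "Q' b = b" if "b \<in> ?X" for b using Q(2)[of b] that by (simp add: Q'_def)
  have Q'0: "Q' b = 0" if "b \<in> B - ?X" for b using Q(2)[of b] that by (auto simp: Q'_def)
  have uX: "u b = l *s b" if "b \<in> ?X" for b using ub[OF that] by simp
  have "sum3_on a1 b1 a2 b2 a3 b3 Q' u"
    using l
  proof
    assume "\<exists>x1 x2 x3. (x1 = a1 \<or> x1 = b1) \<and> (x2 = a2 \<or> x2 = b2) \<and> (x3 = a3 \<or> x3 = b3) \<and>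
      l = x1 + x2 + x3"
    then obtain x1 x2 x3 where x: "x1 = a1 \<or> x1 = b1" "x2 = a2 \<or> x2 = b2" "x3 = a3 \<or> x3 = b3"
      "l = x1 + x2 + x3" by blast
    show ?thesis
    proof (rule sum3_on_scalar[OF lQ' _ _ x(1-3)])
      show "Q' (Q' v) = Q' v" for v by (simp add: Q'_def lin_simps[OF Q(1)] QQ)
      have "u (Q' v) = l *s Q' v" for v
      proof (rule lin_eq_on_span[OF lins(2,3), of _ B])
        show "u (Q' b) = l *s Q' b" if "b \<in> B" for b
          using that Q'X[of b] Q'0[of b] uX[of b] lin_simps(5)[OF u] by (cases "b \<in> ?X") auto
      qed (simp add: B)
      then show "u (Q' v) = (x1 + x2 + x3) *s Q' v" for v using x(4) by simp
    qed
  next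
    assume l: "2 * l = a1 + b1 + a2 + b2 + a3 + b3"
    \<comment> \<open>The two halves of \<open>?X\<close>, both indexed by \<open>?X\<close> itself,
      serve as the families \<open>w\<close> and \<open>k\<close> of
      \<open>sum3_on_double\<close>.\<close>
    obtain f1 f2 where f: "inj_on f1 ?X" "inj_on f2 ?X" "f1 ` ?X \<inter> f2 ` ?X = {}" "f1 ` ?X \<union> f2 ` ?X = ?X"
      by (rule infinite_split_halves[OF inf])
    have fX: "f1 x \<in> ?X" "f2 x \<in> ?X" if "x \<in> ?X" for x
      using f(4) imageI[OF that, of f1] imageI[OF that, of f2] by (simp_all only: set_eq_iff Un_iff) metis+
    have im: "f1 ` ?X \<subseteq> B" "f2 ` ?X \<subseteq> B" using f(4) by blast+
    show ?thesis
    proof (rule sum3_on_double[OF B f(1) im(1) f(2) im(2) f(3) lQ' _ _ _ u _ _ l])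
      show "Q' b = 0" if "b \<in> B - f1 ` ?X - f2 ` ?X" for b
      proof (rule Q'0)
        show "b \<in> B - ?X" using that by (subst f(4)[symmetric]) simp
      qed
    qed (simp_all only: fX[THEN Q'X] fX[THEN uX])
  qed
  then show ?thesis
    by (rule sum3_on_add[OF main _ u]) (simp_all add: Q'_def QQ lin_simps[OF Q(1)])
qed

end

theorem theorem4:
  fixes scale :: "'a::field \<Rightarrow> 'v::ab_group_add \<Rightarrow> 'v"
    and p1 p2 p3 :: "'a poly" and u :: "'v \<Rightarrow> 'v" and l :: 'a
  assumes "vector_space scale"
    and "infinite_dimensional scale"
    and "split_deg2 p1" and "split_deg2 p2" and "split_deg2 p3"
    and "Vector_Spaces.linear scale scale u"
    and "dominant_eigenvalue scale u l"
    and "infinite_rank scale (\<lambda>v. u v - scale l v)"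
    and "is_sum3_scalar p1 p2 p3 l \<or> 2 * l = poly_trace p1 + poly_trace p2 + poly_trace p3"
  shows "is_sum3_endo scale p1 p2 p3 u"
proof -
  interpret endo_space scale
    using assms(1) by (simp add: endo_space_def)
  \<comment> \<open>Only the roots matter until \<open>poly_endo_quadratic\<close> turns the
    quadratic relations back into statements about the polynomials.\<close>
  obtain a1 b1 c1 where p1: "degree p1 = 2" "coeff p1 0 = c1 * (a1 * b1)"
    "coeff p1 (Suc 0) = - (c1 * (a1 + b1))" "coeff p1 2 = c1"
    and t1: "poly_trace p1 = a1 + b1" and r1: "\<And>x. poly p1 x = 0 \<Longrightarrow> x = a1 \<or> x = b1"
    by (rule split_deg2_roots[OF assms(3)]) blast
  obtain a2 b2 c2 where p2: "degree p2 = 2" "coeff p2 0 = c2 * (a2 * b2)"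
    "coeff p2 (Suc 0) = - (c2 * (a2 + b2))" "coeff p2 2 = c2"
    and t2: "poly_trace p2 = a2 + b2" and r2: "\<And>x. poly p2 x = 0 \<Longrightarrow> x = a2 \<or> x = b2"
    by (rule split_deg2_roots[OF assms(4)]) blast
  obtain a3 b3 c3 where p3: "degree p3 = 2" "coeff p3 0 = c3 * (a3 * b3)"
    "coeff p3 (Suc 0) = - (c3 * (a3 + b3))" "coeff p3 2 = c3"
    and t3: "poly_trace p3 = a3 + b3" and r3: "\<And>x. poly p3 x = 0 \<Longrightarrow> x = a3 \<or> x = b3"
    by (rule split_deg2_roots[OF assms(5)]) blast
  obtain R C where R: "independent R" "span R = range (\<lambda>v. u v - scale l v)"
    and C: "independent C" "span C = UNIV" "|R| <o |C|"
    using assms(7) unfolding dominant_eigenvalue_def rank_less_dim_def is_basis_of_def by blast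
  have "infinite R" using assms(8) R(2) unfolding infinite_rank_def by blast
  moreover have "(\<exists>x1 x2 x3. (x1 = a1 \<or> x1 = b1) \<and> (x2 = a2 \<or> x2 = b2) \<and> (x3 = a3 \<or> x3 = b3) \<and>
      l = x1 + x2 + x3) \<or> 2 * l = a1 + b1 + a2 + b2 + a3 + b3"
    using assms(9)
  proof
    assume "is_sum3_scalar p1 p2 p3 l"
    then obtain x1 x2 x3 where "poly p1 x1 = 0" "poly p2 x2 = 0" "poly p3 x3 = 0" "l = x1 + x2 + x3"
      unfolding is_sum3_scalar_def by blast
    with r1[of x1] r2[of x2] r3[of x3] show ?thesis by blast
  next
    assume "2 * l = poly_trace p1 + poly_trace p2 + poly_trace p3"
    then show ?thesis by (simp add: t1 t2 t3 add.assoc)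
  qed
  ultimately have "sum3_on a1 b1 a2 b2 a3 b3 (\<lambda>v. v) u"
    using sum3_on_dominant[OF assms(6) R _ C] by blast
  then obtain u1 u2 u3 where q: "quadratic_on a1 b1 (\<lambda>v. v) u1" "quadratic_on a2 b2 (\<lambda>v. v) u2"
    "quadratic_on a3 b3 (\<lambda>v. v) u3" and s: "\<And>v. u1 v + u2 v + u3 v = u v"
    unfolding sum3_on_def by blast
  have "u = (\<lambda>v. u1 v + u2 v + u3 v)" using s by auto
  then show ?thesis
    unfolding is_sum3_endo_def
    using poly_endo_quadratic[OF q(1) p1] poly_endo_quadratic[OF q(2) p2] poly_endo_quadratic[OF q(3) p3]
      q[unfolded quadratic_on_def] by blast
qed

end
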